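(* Let $n\ge 2$ be an integer and let $H$ be a graph of order $n'\ge 2$ and maximum degree $\Delta(H)\le n'-2$. (i) If $D(H)=2$, then $\dim_s(K_n\circ H)=n\cdot \dim_s(H)$. (ii) If $D(H)> 2$, then $\dim_s(K_n\circ H)=n\cdot \dim_s(K_1+H)$.
   Context: All graphs are simple and undirected. The order of a graph is its number of vertices. $K_n$ is the complete graph on $n$ vertices. $D(H)=\max_{u,v\in V(H)} d_H(u,v)$ is the diameter; if $H$ is not connected, the distance between vertices in different components is infinite and $D(H)=\infty$ (so non-connected $H$ falls under the case $D(H)>2$). The lexicographic product $G\circ H$ has vertex set $V(G)\times V(H)$, and $(a,b),(c,d)$ are adjacent if and only if either $ac\in E(G)$, or ($a=c$ and $bd\in E(H)$). $K_1+H$ denotes the join of $K_1$ and $H$: the graph obtained from $H$ by adding one new vertex adjacent to every vertex of $H$. For a connected graph $F$, a vertex $w$ strongly resolves two vertices $u,v$ if $d_F(w,u)=d_F(w,v)+d_F(v,u)$ or $d_F(w,v)=d_F(w,u)+d_F(u,v)$. A set $S\subseteq V(F)$ is a strong metric generator for $F$ if every two distinct vertices of $F$ are strongly resolved by some vertex of $S$. The strong metric dimension $\dim_s(F)$ is the smallest cardinality of a strong metric generator for $F$. *)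

theory Defs
  imports "Graph_Theory.Graph_Theory"
begin

text \<open>
  Finite simple undirected graphs are rendered by the locale \<open>pair_graph\<close>: a finite vertex set
  together with a symmetric irreflexive arc relation, so an edge \<open>uv\<close> is the pair of arcs
  \<open>(u, v)\<close>, \<open>(v, u)\<close>.
\<close>

text \<open>
  Shortest-path distance with unit arc weights. It is extended-real valued, and infinite between
  vertices of different components; in particular the diameter of a disconnected graph is infinite.
\<close>

definition graph_dist :: "'a pair_pre_digraph \<Rightarrow> 'a \<Rightarrow> 'a \<Rightarrow> ereal" where
  "graph_dist G u v = wf_digraph.\<mu> (with_proj G) (\<lambda>_. 1) u v"

lemma (in pair_wf_digraph) graph_dist_eq_INF_length:
  "graph_dist G u v = (INF p\<in>{p. awalk u p v}. ereal (real (length p)))"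
proof -
  have "awalk_cost (\<lambda>_. 1) p = real (length p)" for p :: "('a \<times> 'a) list"
    by (simp add: awalk_cost_def sum_list_triv)
  then show ?thesis
    by (simp add: graph_dist_def \<mu>_def)
qed

definition graph_diameter :: "'a pair_pre_digraph \<Rightarrow> ereal" where
  "graph_diameter G = (SUP u\<in>pverts G. SUP v\<in>pverts G. graph_dist G u v)"

definition max_degree :: "'a pair_pre_digraph \<Rightarrow> nat" where
  "max_degree G = Max (out_degree (with_proj G) ` pverts G)"

definition lex_product ::
    "'a pair_pre_digraph \<Rightarrow> 'b pair_pre_digraph \<Rightarrow> ('a \<times> 'b) pair_pre_digraph" where
  "lex_product G H =
    \<lparr> pverts = pverts G \<times> pverts H,
      parcs = {((a, b), (c, d)).
        (a, b) \<in> pverts G \<times> pverts H \<and> (c, d) \<in> pverts G \<times> pverts H \<and>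
        ((a, c) \<in> parcs G \<or> a = c \<and> (b, d) \<in> parcs H)} \<rparr>"

text \<open>The join of \<open>K\<^sub>1\<close> and \<open>H\<close>; the added vertex is \<^term>\<open>None\<close>.\<close>

definition K1_join :: "'a pair_pre_digraph \<Rightarrow> 'a option pair_pre_digraph" where
  "K1_join H =
    \<lparr> pverts = insert None (Some ` pverts H),
      parcs = {(Some u, Some v) | u v. (u, v) \<in> parcs H}
        \<union> {(None, Some v) | v. v \<in> pverts H} \<union> {(Some v, None) | v. v \<in> pverts H} \<rparr>"

lemma pair_graph_lex_product:
  assumes "pair_graph G" "pair_graph H"
  shows "pair_graph (lex_product G H)"
proof -
  interpret G: pair_graph G by fact
  interpret H: pair_graph H by fact
  have "finite (parcs (lex_product G H))"
    by (rule finite_subset[of _ "(pverts G \<times> pverts H) \<times> (pverts G \<times> pverts H)"])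
       (auto simp: lex_product_def)
  then show ?thesis
    by unfold_locales
       (auto simp: lex_product_def symmetric_def sym_def
         dest: G.pair_no_loops H.pair_no_loops G.arcs_symmetric H.arcs_symmetric)
qed

lemma pair_graph_K1_join:
  assumes "pair_graph H"
  shows "pair_graph (K1_join H)"
proof -
  interpret H: pair_graph H by fact
  have "finite (parcs (K1_join H))"
    by (rule finite_subset[of _ "insert None (Some ` pverts H) \<times> insert None (Some ` pverts H)"])
       (auto simp: K1_join_def dest: H.wellformed')
  then show ?thesis
    by unfold_locales
       (auto simp: K1_join_def symmetric_def sym_def
         dest: H.pair_no_loops H.arcs_symmetric H.wellformed')
qed

text \<open>
  The following notions are intended for connected graphs only: infinite distances would satisfy
  the additive conditions vacuously.
\<close>

definition strongly_resolves :: "'a pair_pre_digraph \<Rightarrow> 'a \<Rightarrow> 'a \<Rightarrow> 'a \<Rightarrow> bool" where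
  "strongly_resolves F w u v \<longleftrightarrow>
    graph_dist F w u = graph_dist F w v + graph_dist F v u \<or>
    graph_dist F w v = graph_dist F w u + graph_dist F u v"

definition strong_metric_generator :: "'a pair_pre_digraph \<Rightarrow> 'a set \<Rightarrow> bool" where
  "strong_metric_generator F S \<longleftrightarrow> S \<subseteq> pverts F \<and>
    (\<forall>u\<in>pverts F. \<forall>v\<in>pverts F. u \<noteq> v \<longrightarrow> (\<exists>w\<in>S. strongly_resolves F w u v))"

definition strong_metric_dim :: "'a pair_pre_digraph \<Rightarrow> nat" where
  "strong_metric_dim F = (LEAST k. \<exists>S. strong_metric_generator F S \<and> card S = k)"

end

theory Submission
  imports Defs
begin

text \<open>
  In a graph where every distance is 0, 1 or 2, strong resolution is a local matter. A pair that is
  not adjacent is strongly resolved only by its own two members, because a third vertex \<open>w\<close> would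
  need a distance of at least three. An adjacent pair \<open>u, v\<close> is resolved, besides by \<open>u\<close> and
  \<open>v\<close>, by the vertices adjacent to exactly one of them. If there is no such vertex, \<open>u\<close> and
  \<open>v\<close> are true twins and one of the two must be chosen. If \<open>w\<close> is such a vertex, it is
  non-adjacent to one of \<open>u, v\<close>, so a set that meets every non-adjacent pair contains \<open>w\<close> or that
  member, and the pair is resolved anyway. Hence strong metric generators are exactly
  the vertex covers of the auxiliary graph whose edges are the non-adjacent pairs and the
  true twins (\<open>strong_metric_generator_iff_strong_cover\<close>).

  This criterion applies to \<open>K\<^sub>1 + H\<close>, to \<open>K\<^sub>n \<circ> H\<close> with \<open>n \<ge> 2\<close>, and to \<open>H\<close> itself when
  its diameter is two. The degree bound says that no vertex of \<open>H\<close> is adjacent to all others.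
  Therefore the new vertex of the join has no non-neighbour and no twin, and two vertices in
  different copies of \<open>H\<close> in the product are adjacent without being twins. The auxiliary
  graph of the join is thus that of \<open>H\<close> with an isolated vertex added, and that of the product is
  the disjoint union of \<open>n\<close> copies of that of \<open>H\<close>. The minimum size of a cover is unchanged in
  the first case (\<open>strong_cover_number_K1_join\<close>) and multiplied by \<open>n\<close> in the second
  (\<open>strong_cover_number_lex_product\<close>).
\<close>

section \<open>Distances in graphs of diameter at most two\<close>

lemma (in pair_wf_digraph) graph_dist_eqI:
  assumes "awalk u p v" "length p = k" "\<And>q. awalk u q v \<Longrightarrow> k \<le> length q"
  shows "graph_dist G u v = ereal (real k)"
  unfolding graph_dist_eq_INF_length
  using assms by (intro antisym INF_lower2[of p] INF_greatest) auto

text \<open>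
  This is diameter at most two, recorded as a table of distances so that strong resolution can be
  decided by rewriting.
\<close>

definition short_distances :: "'a pair_pre_digraph \<Rightarrow> bool" where
  "short_distances F \<longleftrightarrow> (\<forall>u\<in>pverts F. \<forall>v\<in>pverts F.
     graph_dist F u v = (if u = v then 0 else if (u, v) \<in> parcs F then 1 else 2))"

lemma (in pair_wf_digraph) awalk_short_cases:
  assumes "awalk u p v"
  shows "length p = 0 \<Longrightarrow> u = v"
    and "length p = 1 \<Longrightarrow> (u, v) \<in> parcs G"
    and "length p = 2 \<Longrightarrow> \<exists>w. (u, w) \<in> parcs G \<and> (w, v) \<in> parcs G"
proof -
  show "u = v" if "length p = 0"
    using assms that by (simp add: awalk_Nil_iff)
  show "(u, v) \<in> parcs G" if len: "length p = 1"
  proof -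
    obtain e where "p = [e]" using len by (auto simp: length_Suc_conv)
    with assms show ?thesis by (cases e) (simp add: awalk_Cons_iff awalk_Nil_iff)
  qed
  show "\<exists>w. (u, w) \<in> parcs G \<and> (w, v) \<in> parcs G" if len: "length p = 2"
  proof -
    obtain e f where "p = [e, f]"
      using len by (auto simp: numeral_2_eq_2 length_Suc_conv)
    with assms show ?thesis by (cases e; cases f) (auto simp: awalk_Cons_iff awalk_Nil_iff)
  qed
qed

lemma (in pair_wf_digraph) short_distancesI:
  assumes common: "\<And>u v. u \<in> pverts G \<Longrightarrow> v \<in> pverts G \<Longrightarrow> u \<noteq> v \<Longrightarrow> (u, v) \<notin> parcs G \<Longrightarrow>
     \<exists>w. (u, w) \<in> parcs G \<and> (w, v) \<in> parcs G"
  shows "short_distances G"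
  unfolding short_distances_def
proof (intro ballI)
  fix u v assume uv: "u \<in> pverts G" "v \<in> pverts G"
  show "graph_dist G u v = (if u = v then 0 else if (u, v) \<in> parcs G then 1 else 2)"
  proof (cases "u = v")
    case True
    have "graph_dist G u u = ereal (real 0)"
      using uv by (intro graph_dist_eqI[of u "[]"]) (auto simp: awalk_Nil_iff)
    with True show ?thesis by simp
  next
    case False
    have nonempty: "1 \<le> length q" if "awalk u q v" for q
      using awalk_short_cases(1)[OF that] False by (cases q) auto
    show ?thesis
    proof (cases "(u, v) \<in> parcs G")
      case True
      have "graph_dist G u v = ereal (real 1)"
        using uv True nonempty
        by (intro graph_dist_eqI[of u "[(u, v)]"]) (auto simp: awalk_Cons_iff awalk_Nil_iff)
      with True False show ?thesis by simp
    next
      case nonadj: False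
      then obtain w where w: "(u, w) \<in> parcs G" "(w, v) \<in> parcs G"
        using common uv False by blast
      have "2 \<le> length q" if "awalk u q v" for q
        using awalk_short_cases(2)[OF that] nonempty[OF that] nonadj by linarith
      then have "graph_dist G u v = ereal (real 2)"
        using uv w by (intro graph_dist_eqI[of u "[(u, w), (w, v)]"])
          (auto simp: awalk_Cons_iff awalk_Nil_iff)
      with nonadj False show ?thesis by simp
    qed
  qed
qed

lemma (in pair_wf_digraph) short_distances_if_diameter_le_2:
  assumes "graph_diameter G \<le> 2"
  shows "short_distances G"
proof (rule short_distancesI)
  fix u v assume uv: "u \<in> pverts G" "v \<in> pverts G" "u \<noteq> v" "(u, v) \<notin> parcs G"
  have "graph_dist G u v \<le> graph_diameter G"
    unfolding graph_diameter_def using uv by (meson SUP_upper2 order_refl)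
  also have "\<dots> < ereal 3" using assms by (rule order.strict_trans1) simp
  finally obtain p where p: "awalk u p v" "length p < 3"
    by (auto simp: graph_dist_eq_INF_length INF_less_iff)
  then have "length p = 0 \<or> length p = 1 \<or> length p = 2" by linarith
  then show "\<exists>w. (u, w) \<in> parcs G \<and> (w, v) \<in> parcs G"
    using awalk_short_cases[OF p(1)] uv by blast
qed

section \<open>Strong metric generators as vertex covers\<close>

text \<open>
  When all distances are at most two, these are the mutually maximally distant pairs, that is, the
  edges of what is known as the strong resolving graph. Stating them by adjacency
  instead of distance gives the same pairs for \<open>H\<close> and for its copies inside \<open>K\<^sub>1 + H\<close> and
  \<open>K\<^sub>n \<circ> H\<close>, even when distances in \<open>H\<close> are large or infinite.
\<close>

definition nonadjacent_or_twins :: "'a pair_pre_digraph \<Rightarrow> 'a \<Rightarrow> 'a \<Rightarrow> bool" where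
  "nonadjacent_or_twins F u v \<longleftrightarrow> u \<in> pverts F \<and> v \<in> pverts F \<and> u \<noteq> v \<and>
     ((u, v) \<in> parcs F \<longrightarrow>
       (\<forall>w\<in>pverts F. w \<noteq> u \<longrightarrow> w \<noteq> v \<longrightarrow> ((w, u) \<in> parcs F \<longleftrightarrow> (w, v) \<in> parcs F)))"

definition strong_cover :: "'a pair_pre_digraph \<Rightarrow> 'a set \<Rightarrow> bool" where
  "strong_cover F S \<longleftrightarrow> S \<subseteq> pverts F \<and> (\<forall>u v. nonadjacent_or_twins F u v \<longrightarrow> u \<in> S \<or> v \<in> S)"

definition strong_cover_number :: "'a pair_pre_digraph \<Rightarrow> nat" where
  "strong_cover_number F = (LEAST k. \<exists>S. strong_cover F S \<and> card S = k)"

lemma strong_cover_number_le: "strong_cover F S \<Longrightarrow> strong_cover_number F \<le> card S"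
  unfolding strong_cover_number_def by (rule Least_le) blast

lemma strong_cover_number_attained:
  obtains S where "strong_cover F S" "card S = strong_cover_number F"
proof -
  have "strong_cover F (pverts F)"
    by (auto simp: strong_cover_def nonadjacent_or_twins_def)
  then have "\<exists>k S. strong_cover F S \<and> card S = k" by blast
  from LeastI_ex[OF this] show ?thesis
    using that unfolding strong_cover_number_def by blast
qed

lemma strong_cover_number_eqI:
  assumes "strong_cover F S" "card S = k" "\<And>T. strong_cover F T \<Longrightarrow> k \<le> card T"
  shows "strong_cover_number F = k"
proof (rule antisym)
  show "strong_cover_number F \<le> k"
    using strong_cover_number_le assms(1,2) by blast
  show "k \<le> strong_cover_number F"
    using strong_cover_number_attained assms(3) by metis
qed

text \<open>
  For \<open>w\<close> different from \<open>u\<close> and \<open>v\<close>, an equation \<open>d(w,u) = d(w,v) + d(v,u)\<close> between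
  distances 1 and 2 can only read \<open>2 = 1 + 1\<close>.
\<close>

lemma strongly_resolves_iff:
  assumes "short_distances F" "symmetric (with_proj F)"
    and "u \<in> pverts F" "v \<in> pverts F" "w \<in> pverts F" "u \<noteq> v"
  shows "strongly_resolves F w u v \<longleftrightarrow>
    w = u \<or> w = v \<or> (u, v) \<in> parcs F \<and> ((w, u) \<in> parcs F \<longleftrightarrow> (w, v) \<notin> parcs F)"
proof -
  have sym: "(u, v) \<in> parcs F \<longleftrightarrow> (v, u) \<in> parcs F"
    using assms(2) by (auto simp: symmetric_def dest: symD)
  have d: "graph_dist F x y = (if x = y then 0 else if (x, y) \<in> parcs F then 1 else 2)"
    if "x \<in> pverts F" "y \<in> pverts F" for x y
    using assms(1) that by (auto simp: short_distances_def)
  show ?thesis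
    using assms(3-6) sym by (auto simp: strongly_resolves_def d)
qed

text \<open>
  A vertex that could resolve an adjacent pair must be shown to lie in the cover. It does, because
  such a vertex has a non-neighbour in the pair, and the pair avoids the cover.
\<close>

lemma strong_metric_generator_iff_strong_cover:
  assumes short: "short_distances F" and symF: "symmetric (with_proj F)"
  shows "strong_metric_generator F S \<longleftrightarrow> strong_cover F S"
proof
  assume gen: "strong_metric_generator F S"
  show "strong_cover F S"
    unfolding strong_cover_def
  proof (intro conjI allI impI)
    show "S \<subseteq> pverts F" using gen by (simp add: strong_metric_generator_def)
    fix u v assume uv: "nonadjacent_or_twins F u v"
    then obtain w where "w \<in> S" "w \<in> pverts F" "strongly_resolves F w u v"
      using gen by (fastforce simp: strong_metric_generator_def nonadjacent_or_twins_def)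
    then show "u \<in> S \<or> v \<in> S"
      using uv strongly_resolves_iff[OF short symF, of u v w]
      by (auto simp: nonadjacent_or_twins_def)
  qed
next
  assume cov: "strong_cover F S"
  then have SF: "S \<subseteq> pverts F" by (simp add: strong_cover_def)
  have symD': "(x, y) \<in> parcs F \<Longrightarrow> (y, x) \<in> parcs F" for x y
    using symF by (auto simp: symmetric_def dest: symD)
  show "strong_metric_generator F S"
    unfolding strong_metric_generator_def
  proof (intro conjI ballI impI SF)
    fix u v assume uv: "u \<in> pverts F" "v \<in> pverts F" "u \<noteq> v"
    note resolves = strongly_resolves_iff[OF short symF uv(1,2) _ uv(3)]
    show "\<exists>w\<in>S. strongly_resolves F w u v"
    proof (cases "u \<in> S \<or> v \<in> S")
      case True
      then show ?thesis using resolves uv by blast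
    next
      case False
      then have "\<not> nonadjacent_or_twins F u v" using cov by (auto simp: strong_cover_def)
      then obtain w where w: "(u, v) \<in> parcs F" "w \<in> pverts F" "w \<noteq> u" "w \<noteq> v"
        "(w, u) \<in> parcs F \<longleftrightarrow> (w, v) \<notin> parcs F"
        using uv by (auto simp: nonadjacent_or_twins_def)
      \<comment> \<open>One of these two pairs is non-adjacent; \<open>u\<close> and \<open>v\<close> lie outside \<open>S\<close>, so \<open>w\<close> must cover it.\<close>
      then have "nonadjacent_or_twins F w u \<or> nonadjacent_or_twins F w v"
        using uv by (auto simp: nonadjacent_or_twins_def)
      then have "w \<in> S" using cov False by (auto simp: strong_cover_def)
      then show ?thesis using resolves w by blast
    qed
  qed
qed

lemma strong_metric_dim_eq_strong_cover_number:
  assumes "short_distances F" "symmetric (with_proj F)"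
  shows "strong_metric_dim F = strong_cover_number F"
  by (simp add: strong_metric_dim_def strong_cover_number_def
      strong_metric_generator_iff_strong_cover[OF assms])

section \<open>Covers of the join and of the lexicographic product\<close>

definition no_dominating_vertex :: "'a pair_pre_digraph \<Rightarrow> bool" where
  "no_dominating_vertex H \<longleftrightarrow> (\<forall>v\<in>pverts H. \<exists>w\<in>pverts H. w \<noteq> v \<and> (w, v) \<notin> parcs H)"

text \<open>
  A vertex adjacent to all others has degree \<open>|V| - 1\<close>. With fewer than two vertices the
  subtraction would truncate to 0 and a one-vertex graph would satisfy the bound.
\<close>

lemma no_dominating_vertex_if_max_degree:
  assumes "pair_graph H" "card (pverts H) \<ge> 2" "max_degree H \<le> card (pverts H) - 2"
  shows "no_dominating_vertex H"
  unfolding no_dominating_vertex_def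
proof (rule ballI, rule ccontr)
  interpret H: pair_graph H by fact
  fix v assume v: "v \<in> pverts H" and dom: "\<not> (\<exists>w\<in>pverts H. w \<noteq> v \<and> (w, v) \<notin> parcs H)"
  have "card (pverts H) - 1 = card (Pair v ` (pverts H - {v}))"
    using v by (simp add: card_image inj_on_def)
  also have "\<dots> \<le> card (out_arcs (with_proj H) v)"
    using dom by (intro card_mono)
      (auto simp: out_arcs_def intro: H.arcs_symmetric finite_subset[OF _ H.pair_finite_arcs])
  also have "\<dots> \<le> max_degree H"
    using v unfolding max_degree_def out_degree_def[symmetric] by (intro Max_ge) auto
  finally show False using assms(2,3) by simp
qed

lemma short_distances_K1_join:
  assumes "pair_graph H"
  shows "short_distances (K1_join H)"
proof -
  interpret J: pair_graph "K1_join H" by (rule pair_graph_K1_join[OF assms])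
  show ?thesis by (rule J.short_distancesI) (auto simp: K1_join_def)
qed

lemma pair_graph_lex_product_complete:
  assumes "complete_digraph n (with_proj K)" "pair_graph H"
  shows "pair_graph (lex_product K H)"
  by (rule pair_graph_lex_product[OF pair_graphI_complete[OF assms(1)] assms(2)])

lemma short_distances_lex_product:
  assumes "complete_digraph n (with_proj K)" "n \<ge> 2" "pair_graph H"
  shows "short_distances (lex_product K H)"
proof -
  interpret L: pair_graph "lex_product K H"
    by (rule pair_graph_lex_product_complete[OF assms(1,3)])
  note K = complete_digraph_pair_def[THEN iffD1, OF assms(1)]
  show ?thesis
  proof (rule L.short_distancesI)
    fix x y assume xy: "x \<in> pverts (lex_product K H)" "y \<in> pverts (lex_product K H)"
      "(x, y) \<notin> parcs (lex_product K H)"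
    obtain a b c d where eqs: "x = (a, b)" "y = (c, d)" by fastforce
    have mem: "a \<in> pverts K" "b \<in> pverts H" "d \<in> pverts H"
      using xy by (auto simp: eqs lex_product_def)
    have "a = c" using xy K by (auto simp: eqs lex_product_def)
    have "card {a} < card (pverts K)" using K assms(2) by simp
    then have "\<not> pverts K \<subseteq> {a}" by (meson card_mono finite.intros leD)
    \<comment> \<open>Any vertex in another copy of \<open>H\<close> is a common neighbour of \<open>x\<close> and \<open>y\<close>.\<close>
    then obtain e where "e \<in> pverts K" "e \<noteq> a" by blast
    then have "(x, (e, b)) \<in> parcs (lex_product K H)" "((e, b), y) \<in> parcs (lex_product K H)"
      using mem K \<open>a = c\<close> by (auto simp: eqs lex_product_def)
    then show "\<exists>w. (x, w) \<in> parcs (lex_product K H) \<and> (w, y) \<in> parcs (lex_product K H)"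
      by blast
  qed
qed

text \<open>
  The new vertex is adjacent to each \<open>v\<close>, and a non-neighbour of \<open>v\<close> in \<open>H\<close> distinguishes the two.
\<close>

lemma nonadjacent_or_twins_K1_join:
  assumes "no_dominating_vertex H"
  shows "nonadjacent_or_twins (K1_join H) x y \<longleftrightarrow>
    (\<exists>u v. x = Some u \<and> y = Some v \<and> nonadjacent_or_twins H u v)"
proof -
  have verts: "pverts (K1_join H) = insert None (Some ` pverts H)"
    by (simp add: K1_join_def)
  have adj: "(Some u, Some v) \<in> parcs (K1_join H) \<longleftrightarrow> (u, v) \<in> parcs H"
    "(None, Some v) \<in> parcs (K1_join H) \<longleftrightarrow> v \<in> pverts H"
    "(Some v, None) \<in> parcs (K1_join H) \<longleftrightarrow> v \<in> pverts H" for u v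
    by (auto simp: K1_join_def)
  have "\<not> nonadjacent_or_twins (K1_join H) None (Some v)"
    "\<not> nonadjacent_or_twins (K1_join H) (Some v) None" for v
    using assms by (force simp: nonadjacent_or_twins_def no_dominating_vertex_def verts adj)+
  moreover have "\<not> nonadjacent_or_twins (K1_join H) None None"
    by (simp add: nonadjacent_or_twins_def)
  moreover have "nonadjacent_or_twins (K1_join H) (Some u) (Some v) \<longleftrightarrow>
      nonadjacent_or_twins H u v" for u v
    by (auto simp: nonadjacent_or_twins_def verts adj)
  ultimately show ?thesis by (cases x; cases y) simp_all
qed

lemma strong_cover_number_K1_join:
  assumes "finite (pverts H)" "no_dominating_vertex H"
  shows "strong_cover_number (K1_join H) = strong_cover_number H"
proof -
  note mmd = nonadjacent_or_twins_K1_join[OF assms(2)]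
  have verts: "pverts (K1_join H) = insert None (Some ` pverts H)"
    by (simp add: K1_join_def)
  obtain S where S: "strong_cover H S" "card S = strong_cover_number H"
    by (rule strong_cover_number_attained)
  show ?thesis
  proof (rule strong_cover_number_eqI)
    show "strong_cover (K1_join H) (Some ` S)"
      using S(1) unfolding strong_cover_def mmd verts by blast
    show "card (Some ` S) = strong_cover_number H" using S(2) by (simp add: card_image)
    fix T assume T: "strong_cover (K1_join H) T"
    then have "finite T"
      using assms(1) by (auto simp: strong_cover_def verts intro: finite_subset)
    have "strong_cover H (Some -` T)"
      using T by (auto simp: strong_cover_def mmd verts)
    then have "strong_cover_number H \<le> card (Some -` T)" by (rule strong_cover_number_le)
    also have "\<dots> \<le> card T"
      using \<open>finite T\<close> by (intro card_inj_on_le[of Some]) auto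
    finally show "strong_cover_number H \<le> card T" .
  qed
qed

text \<open>
  Within one copy of \<open>H\<close>, vertices of other copies are adjacent to everything and so cannot
  separate twins. Across copies, a non-neighbour \<open>w\<close> of \<open>u\<close> in \<open>H\<close> gives \<open>(a, w)\<close>, which is
  adjacent to \<open>(c, v)\<close> but not to \<open>(a, u)\<close>.
\<close>

lemma nonadjacent_or_twins_lex_product:
  assumes "complete_digraph n (with_proj K)" "no_dominating_vertex H"
  shows "nonadjacent_or_twins (lex_product K H) (a, u) (c, v) \<longleftrightarrow>
    a = c \<and> a \<in> pverts K \<and> nonadjacent_or_twins H u v"
proof -
  have K: "(x, y) \<in> parcs K \<longleftrightarrow> x \<in> pverts K \<and> y \<in> pverts K \<and> x \<noteq> y" for x y
    using assms(1) by (auto simp: complete_digraph_pair_def)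
  have adj: "((x, p), (y, q)) \<in> parcs (lex_product K H) \<longleftrightarrow>
      x \<in> pverts K \<and> y \<in> pverts K \<and> p \<in> pverts H \<and> q \<in> pverts H \<and>
      (x = y \<longrightarrow> (p, q) \<in> parcs H)" for x y p q
    by (auto simp: lex_product_def K)
  have verts: "pverts (lex_product K H) = pverts K \<times> pverts H"
    by (simp add: lex_product_def)
  show ?thesis
  proof (cases "a = c")
    case True
    then show ?thesis
      by (auto simp: nonadjacent_or_twins_def verts adj)
  next
    case False
    have "\<not> nonadjacent_or_twins (lex_product K H) (a, u) (c, v)"
    proof
      assume mmd: "nonadjacent_or_twins (lex_product K H) (a, u) (c, v)"
      then have mem: "a \<in> pverts K" "c \<in> pverts K" "u \<in> pverts H" "v \<in> pverts H"
        by (auto simp: nonadjacent_or_twins_def verts)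
      then obtain w where "w \<in> pverts H" "w \<noteq> u" "(w, u) \<notin> parcs H"
        using assms(2) by (auto simp: no_dominating_vertex_def)
      then have w: "((a, w), (a, u)) \<notin> parcs (lex_product K H)"
        "((a, w), (c, v)) \<in> parcs (lex_product K H)" "((a, u), (c, v)) \<in> parcs (lex_product K H)"
        "(a, w) \<in> pverts (lex_product K H)" "(a, w) \<noteq> (a, u)" "(a, w) \<noteq> (c, v)"
        using mem False by (auto simp: adj verts)
      from mmd w(3-6) have "((a, w), (a, u)) \<in> parcs (lex_product K H) \<longleftrightarrow>
          ((a, w), (c, v)) \<in> parcs (lex_product K H)"
        by (simp only: nonadjacent_or_twins_def simp_thms)
      with w(1,2) show False by simp
    qed
    with False show ?thesis by simp
  qed
qed

text \<open>
  A set is a cover of the product if and only if its slice in each copy is a cover of \<open>H\<close>, so the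
  slices can be minimised independently.
\<close>

lemma strong_cover_number_lex_product:
  assumes "complete_digraph n (with_proj K)" "finite (pverts H)" "no_dominating_vertex H"
  shows "strong_cover_number (lex_product K H) = n * strong_cover_number H"
proof -
  note mmd = nonadjacent_or_twins_lex_product[OF assms(1,3)]
  have K: "card (pverts K) = n" "finite (pverts K)"
    using assms(1) by (auto simp: complete_digraph_pair_def)
  obtain S where S: "strong_cover H S" "card S = strong_cover_number H"
    by (rule strong_cover_number_attained)
  show ?thesis
  proof (rule strong_cover_number_eqI)
    show "strong_cover (lex_product K H) (pverts K \<times> S)"
      using S(1) by (auto simp: strong_cover_def mmd) (auto simp: lex_product_def)
    show "card (pverts K \<times> S) = n * strong_cover_number H"
      using S(2) K by (simp add: card_cartesian_product)
    fix T assume T: "strong_cover (lex_product K H) T"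
    then have TV: "T \<subseteq> pverts K \<times> pverts H" by (simp add: strong_cover_def lex_product_def)
    have "strong_cover H (T `` {a})" if "a \<in> pverts K" for a
      using T TV that by (auto simp: strong_cover_def mmd)
    then have "(\<Sum>a\<in>pverts K. strong_cover_number H) \<le> (\<Sum>a\<in>pverts K. card (T `` {a}))"
      by (intro sum_mono strong_cover_number_le)
    also have "\<dots> = card (Sigma (pverts K) (\<lambda>a. T `` {a}))"
      using K(2) TV assms(2) by (intro card_SigmaI[symmetric]) (auto intro: finite_subset)
    also have "Sigma (pverts K) (\<lambda>a. T `` {a}) = T" using TV by auto
    finally show "n * strong_cover_number H \<le> card T" using K(1) by simp
  qed
qed

theorem theorem14:
  fixes n n' :: nat
    and K :: "'b pair_pre_digraph"
    and H :: "'a pair_pre_digraph"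
  assumes "n \<ge> 2"
    and "complete_digraph n (with_proj K)"
    and "pair_graph H"
    and "card (pverts H) = n'"
    and "n' \<ge> 2"
    and "max_degree H \<le> n' - 2"
  shows "(graph_diameter H = 2 \<longrightarrow>
            strong_metric_dim (lex_product K H) = n * strong_metric_dim H) \<and>
         (graph_diameter H > 2 \<longrightarrow>
            strong_metric_dim (lex_product K H) = n * strong_metric_dim (K1_join H))"
proof -
  interpret H: pair_graph H by fact
  interpret J: pair_graph "K1_join H" by (rule pair_graph_K1_join) fact
  interpret L: pair_graph "lex_product K H"
    by (rule pair_graph_lex_product_complete) fact+
  have H: "no_dominating_vertex H"
    using assms by (intro no_dominating_vertex_if_max_degree) auto
  have "strong_metric_dim (lex_product K H) = n * strong_cover_number H"
    using strong_metric_dim_eq_strong_cover_number[OF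
        short_distances_lex_product[OF assms(2,1,3)] L.pair_sym_arcs]
      strong_cover_number_lex_product[OF assms(2) H.pair_finite_verts H] by simp
  moreover have "strong_metric_dim (K1_join H) = strong_cover_number H"
    using strong_metric_dim_eq_strong_cover_number[OF
        short_distances_K1_join[OF assms(3)] J.pair_sym_arcs]
      strong_cover_number_K1_join[OF H.pair_finite_verts H] by simp
  moreover have "strong_metric_dim H = strong_cover_number H" if "graph_diameter H = 2"
    using that by (intro strong_metric_dim_eq_strong_cover_number
        H.short_distances_if_diameter_le_2) (auto intro: H.pair_sym_arcs)
  ultimately show ?thesis by simp
qed

end
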